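(* Let $\Gamma=(V,E,w)$ be a finite, simple, connected, undirected weighted graph with $V=V_0\sqcup V_b$ and $V_b\neq\emptyset$. For each $n\in\mathbb{N}$ let $\rho^n:V\to\mathbb{R}$, and assume that there is $\delta>0$ such that $0\le\rho^n(x)\le 1-\delta$ for all $x\in V$ and all $n\in\mathbb{N}$. Then for every $n\in\mathbb{N}$ there exists a unique function $u^n:V\to\mathbb{R}$ satisfying $$\max_{y\sim x}\left\{-\frac{u^n(y)-u^n(x)}{w_{yx}}-\frac{1}{1-\rho^n(y)}\right\}=0\quad\text{for all }x\in V_0,\qquad u^n(x)=0\quad\text{for all }x\in V_b,$$ and it is given, for all $x\in V$, by $$u^n(x)=\min\left\{\sum_{k=0}^{N-1}\frac{w_{x_{k+1}x_k}}{1-\rho^n(x_{k+1})}\;:\;y\in V_b,\ \gamma=\{x_0=x,x_1,\dots,x_N=y\}\in\mathcal{G}_{xy}\right\},$$ with the convention $\sum_{k=0}^{-1}=0$.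
   Context: The graph $\Gamma=(V,E,w)$ has vertex set $V$, edge set $E\subset V\times V$ and weights $w:V\times V\to\mathbb{R}$, $w_{xy}:=w(x,y)$, with $w_{xy}>0$ if $(x,y)\in E$, $w_{xy}=0$ otherwise, and $w_{xy}=w_{yx}$. One writes $y\sim x$ if $(x,y)\in E$; in the maximum, $y$ ranges over all $y\in V$ with $y\sim x$. The set $V_b\subset V$ is a designated set of boundary vertices and $V_0=V\setminus V_b$ is the set of internal vertices. A path connecting $x$ to $y$ is a finite list $\gamma=\{x_0=x,x_1,\dots,x_N=y\}$ of vertices such that $x_k\sim x_{k+1}$ for $k=0,\dots,N-1$; the stationary path $\{x_0=x\}$ ($N=0$) is allowed as a path from $x$ to $x$. $\mathcal{G}_{xy}$ denotes the set of all paths connecting $x$ to $y$. *)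

theory Defs
  imports Complex_Main "HOL-Library.FuncSet" "Graph_Theory.Graph_Theory"
begin

(* An undirected graph is a symmetric set of ordered pairs: pair_graph is finite, loopless and
   symmetric, and without parallel edges by the choice of representation. *)

definition edge_weights :: "'a pair_pre_digraph \<Rightarrow> ('a \<Rightarrow> 'a \<Rightarrow> real) \<Rightarrow> bool" where
  "edge_weights G w \<longleftrightarrow>
     (\<forall>x\<in>pverts G. \<forall>y\<in>pverts G.
        ((x, y) \<in> parcs G \<longrightarrow> w x y > 0) \<and>
        ((x, y) \<notin> parcs G \<longrightarrow> w x y = 0) \<and>
        w x y = w y x)"

(* Max is a genuine maximum here when the graph is finite and x is not isolated; in a connected
   graph the latter holds for every interior x as soon as Vb is nonempty. *)
definition eikonal_solution ::
  "'a pair_pre_digraph \<Rightarrow> ('a \<Rightarrow> 'a \<Rightarrow> real) \<Rightarrow> 'a set \<Rightarrow> ('a \<Rightarrow> real) \<Rightarrow> ('a \<Rightarrow> real) \<Rightarrow> bool" where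
  "eikonal_solution G w Vb \<rho> u \<longleftrightarrow>
     (\<forall>x\<in>pverts G - Vb.
        Max ((\<lambda>y. - ((u y - u x) / w y x) - 1 / (1 - \<rho> y)) ` {y. (x, y) \<in> parcs G}) = 0) \<and>
     (\<forall>x\<in>Vb. u x = 0)"

(* Repeated vertices are allowed; the singleton list is the stationary path. *)
definition vertex_paths :: "'a pair_pre_digraph \<Rightarrow> 'a \<Rightarrow> 'a \<Rightarrow> 'a list set" where
  "vertex_paths G x y = {p. vwalk p (with_proj G) \<and> hd p = x \<and> last p = y}"

(* A path with vertices x_0, ..., x_N is a list of length N + 1. *)
definition path_cost :: "('a \<Rightarrow> 'a \<Rightarrow> real) \<Rightarrow> ('a \<Rightarrow> real) \<Rightarrow> 'a list \<Rightarrow> real" where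
  "path_cost w \<rho> p = (\<Sum>k<length p - 1. w (p ! (k + 1)) (p ! k) / (1 - \<rho> (p ! (k + 1))))"

(* The operator Min is specified only on finite sets, whereas the set of path costs is
   in general infinite. *)
definition is_minimum :: "'a::order set \<Rightarrow> 'a \<Rightarrow> bool" where
  "is_minimum S m \<longleftrightarrow> m \<in> S \<and> (\<forall>s\<in>S. m \<le> s)"

end

theory Submission
  imports Defs
begin

(* The equation is the Bellman equation u x = min_{y ~ x} (u y + c x y) for the shortest path
   problem with the asymmetric arc costs c x y = w y x / (1 - rho y) > 0 and targets Vb.  Along any
   path the inequality part gives u x \<le> cost; following minimizing arcs makes u strictly decrease,
   so in a finite graph this ends in Vb and produces a path of cost exactly u x.  Thus a solution is
   the minimal cost; conversely the infimum of the path costs solves the Bellman equation. *)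

lemma is_minimum_unique: "is_minimum S a \<Longrightarrow> is_minimum S b \<Longrightarrow> a = b"
  unfolding is_minimum_def by (meson antisym)

lemma path_cost_singleton [simp]: "path_cost w \<rho> [x] = 0"
  by (simp add: path_cost_def)

lemma path_cost_Cons_Cons [simp]:
  "path_cost w \<rho> (x # y # p) = w y x / (1 - \<rho> y) + path_cost w \<rho> (y # p)"
  unfolding path_cost_def by (simp add: sum.lessThan_Suc_shift del: sum.lessThan_Suc)

text \<open>One time step is fixed. The uniform bound on the density enters as
  \<open>\<rho>_less_1\<close>, which keeps all denominators positive.\<close>

locale eikonal_graph = pair_graph G for G :: "'a pair_pre_digraph" +
  fixes w :: "'a \<Rightarrow> 'a \<Rightarrow> real" and Vb :: "'a set" and \<rho> :: "'a \<Rightarrow> real"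
  assumes conn: "Digraph_Component.connected (with_proj G)"
    and weights: "edge_weights G w"
    and Vb_subset: "Vb \<subseteq> pverts G" and Vb_nonempty: "Vb \<noteq> {}"
    and \<rho>_less_1: "x \<in> pverts G \<Longrightarrow> \<rho> x < 1"
begin

section \<open>Costs of paths into the boundary\<close>

text \<open>The density is sampled at the head \<open>y\<close>, so the cost depends on the
  direction of travel although \<open>w\<close> is symmetric.\<close>

definition arc_cost :: "'a \<Rightarrow> 'a \<Rightarrow> real" where
  "arc_cost x y = w y x / (1 - \<rho> y)"

definition boundary_costs :: "'a \<Rightarrow> real set" where
  "boundary_costs x = {path_cost w \<rho> p | y p. y \<in> Vb \<and> p \<in> vertex_paths G x y}"

lemma weight_pos: "(x, y) \<in> parcs G \<Longrightarrow> w y x > 0"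
  using weights in_arcsD1 in_arcsD2 unfolding edge_weights_def by metis

lemma arc_cost_pos: "(x, y) \<in> parcs G \<Longrightarrow> arc_cost x y > 0"
  using weight_pos \<rho>_less_1 in_arcsD2 unfolding arc_cost_def by simp

lemma boundary_costs_eq:
  "boundary_costs x =
     {path_cost w \<rho> p | p. vwalk p (with_proj G) \<and> hd p = x \<and> last p \<in> Vb}"
  unfolding boundary_costs_def vertex_paths_def by auto

lemma path_cost_nonneg: "vwalk p (with_proj G) \<Longrightarrow> 0 \<le> path_cost w \<rho> p"
proof (induct rule: vwalk_induct)
  case (Cons u v es)
  then show ?case
    using arc_cost_pos[of u v] by (simp add: arc_cost_def)
qed simp

lemma boundary_costs_nonneg: "s \<in> boundary_costs x \<Longrightarrow> 0 \<le> s"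
  unfolding boundary_costs_eq using path_cost_nonneg by auto

text \<open>In a symmetric digraph connectedness is strong connectedness, so a walk leads from
  \<open>x\<close> to any chosen boundary vertex.\<close>

lemma boundary_costs_nonempty:
  assumes "x \<in> pverts G"
  shows "boundary_costs x \<noteq> {}"
proof -
  obtain y where y: "y \<in> Vb" using Vb_nonempty by auto
  have "strongly_connected (with_proj G)"
    using symmetric_connected_imp_strongly_connected[OF pair_sym_arcs conn] .
  then have "x \<rightarrow>\<^sup>*\<^bsub>with_proj G\<^esub> y"
    using assms y Vb_subset unfolding strongly_connected_def by auto
  then obtain p where "vwalk p (with_proj G)" "hd p = x" "last p = y"
    using reachable_vwalk_conv by blast
  then show ?thesis
    using y unfolding boundary_costs_eq by blast
qed

lemma zero_in_boundary_costs: "x \<in> Vb \<Longrightarrow> 0 \<in> boundary_costs x"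
  unfolding boundary_costs_eq using Vb_subset
  by (auto intro!: exI[of _ "[x]"] vwalkI)

lemma boundary_costs_step:
  assumes "(x, y) \<in> parcs G" and "t \<in> boundary_costs y"
  shows "t + arc_cost x y \<in> boundary_costs x"
proof -
  obtain p where p: "vwalk p (with_proj G)" "hd p = y" "last p \<in> Vb" "t = path_cost w \<rho> p"
    using assms(2) unfolding boundary_costs_eq by auto
  then obtain q where q: "p = y # q" by (cases p) auto
  have "vwalk (x # p) (with_proj G)"
    using p assms(1) in_arcsD1 by (intro vwalk_consI) auto
  then show ?thesis
    using p q unfolding boundary_costs_eq arc_cost_def
    by (auto intro!: exI[of _ "x # p"])
qed

text \<open>Converse of \<open>boundary_costs_step\<close>: a path from an interior vertex to the
  boundary has a first arc, and the rest still ends in \<open>Vb\<close>. Together they form the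
  dynamic programming recursion.\<close>

lemma boundary_costs_cases:
  assumes "s \<in> boundary_costs x" and "x \<notin> Vb"
  obtains y t where "(x, y) \<in> parcs G" "t \<in> boundary_costs y" "s = t + arc_cost x y"
proof -
  obtain p where p: "vwalk p (with_proj G)" "hd p = x" "last p \<in> Vb" "s = path_cost w \<rho> p"
    using assms(1) unfolding boundary_costs_eq by auto
  then obtain q where q: "p = x # q" by (cases p) auto
  \<comment> \<open>The path cannot be the stationary \<open>[x]\<close>, since its last vertex lies
    in \<open>Vb\<close> and \<open>x\<close> does not.\<close>
  then obtain y r where r: "p = x # y # r"
    using p assms(2) by (cases q) auto
  then have "(x, y) \<in> parcs G" "vwalk (y # r) (with_proj G)"
    using p by (auto elim: vwalk_consE)
  moreover have "path_cost w \<rho> (y # r) \<in> boundary_costs y"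
    using calculation p r unfolding boundary_costs_eq by auto
  ultimately show ?thesis
    using that p r by (simp add: arc_cost_def)
qed

section \<open>The equation in Bellman form\<close>

lemma finite_neighbours: "finite {y. (x, y) \<in> parcs G}"
  by (rule finite_subset[OF _ pair_finite_verts]) (auto dest: in_arcsD2)

lemma neighbours_nonempty:
  assumes "x \<in> pverts G - Vb"
  shows "{y. (x, y) \<in> parcs G} \<noteq> {}"
proof -
  obtain s where "s \<in> boundary_costs x"
    using assms boundary_costs_nonempty by blast
  then show ?thesis
    using assms boundary_costs_cases by blast
qed

text \<open>Up to the positive factor \<open>1 / w y x\<close>, each term of the maximum is the
  Bellman defect \<open>u x - (u y + arc_cost x y)\<close>. The maximum vanishes iff no defect is
  positive and some defect is zero.\<close>

lemma eikonal_solution_iff_Bellman: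
  "eikonal_solution G w Vb \<rho> u \<longleftrightarrow>
     (\<forall>x\<in>pverts G - Vb.
        (\<forall>y. (x, y) \<in> parcs G \<longrightarrow> u x \<le> u y + arc_cost x y) \<and>
        (\<exists>y. (x, y) \<in> parcs G \<and> u x = u y + arc_cost x y)) \<and>
     (\<forall>x\<in>Vb. u x = 0)"
proof -
  have "Max ((\<lambda>y. - ((u y - u x) / w y x) - 1 / (1 - \<rho> y)) ` {y. (x, y) \<in> parcs G}) = 0 \<longleftrightarrow>
      (\<forall>y. (x, y) \<in> parcs G \<longrightarrow> u x \<le> u y + arc_cost x y) \<and>
      (\<exists>y. (x, y) \<in> parcs G \<and> u x = u y + arc_cost x y)"
    (is "Max (?f ` ?N) = 0 \<longleftrightarrow> ?B") if x: "x \<in> pverts G - Vb" for x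
  proof -
    define f where "f = ?f"
    have f: "f y = (u x - (u y + arc_cost x y)) / w y x" if "(x, y) \<in> parcs G" for y
      using weight_pos[OF that] by (simp add: f_def arc_cost_def field_simps)
    have le: "f y \<le> 0 \<longleftrightarrow> u x \<le> u y + arc_cost x y" if "(x, y) \<in> parcs G" for y
      unfolding f[OF that] using weight_pos[OF that] by (simp add: divide_le_0_iff)
    have eq: "f y = 0 \<longleftrightarrow> u x = u y + arc_cost x y" if "(x, y) \<in> parcs G" for y
      unfolding f[OF that] using weight_pos[OF that] by simp
    have "Max (f ` ?N) = 0 \<longleftrightarrow> 0 \<in> f ` ?N \<and> (\<forall>a\<in>f ` ?N. a \<le> 0)"
      using finite_neighbours neighbours_nonempty[OF x] by (intro Max_eq_iff) auto
    also have "\<dots> \<longleftrightarrow> (\<exists>y\<in>?N. f y = 0) \<and> (\<forall>y\<in>?N. f y \<le> 0)"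
      by (auto simp: image_iff eq_commute[of "0::real"])
    also have "\<dots> \<longleftrightarrow> ?B"
      using le eq by auto
    finally show ?thesis unfolding f_def .
  qed
  then show ?thesis
    unfolding eikonal_solution_def by simp
qed

section \<open>Solutions as minimal path costs\<close>

lemma solution_le_path_cost:
  assumes "eikonal_solution G w Vb \<rho> u" and "s \<in> boundary_costs x"
  shows "u x \<le> s"
proof -
  have "u (hd p) \<le> path_cost w \<rho> p" if "vwalk p (with_proj G)" "last p \<in> Vb" for p
    using that
  proof (induct p rule: induct_list012)
    case (2 x)
    then show ?case
      using assms(1) unfolding eikonal_solution_def by simp
  next
    case (3 x y q)
    have xy: "(x, y) \<in> parcs G" and q: "vwalk (y # q) (with_proj G)"
      using 3(3) by (auto elim: vwalk_consE)
    show ?case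
    \<comment> \<open>A path may meet \<open>Vb\<close> before its end, where no Bellman inequality
      is available; there \<open>u x = 0\<close> and nonnegativity of costs suffice.\<close>
    proof (cases "x \<in> Vb")
      case True
      then have "u x = 0"
        using assms(1) unfolding eikonal_solution_def by simp
      then show ?thesis
        using path_cost_nonneg[OF 3(3)] by simp
    next
      case False
      then have "u x \<le> u y + arc_cost x y"
        using xy in_arcsD1 assms(1) unfolding eikonal_solution_iff_Bellman by blast
      moreover have "u y \<le> path_cost w \<rho> (y # q)"
        using 3(2)[OF q] 3(4) by simp
      ultimately show ?thesis
        by (simp add: arc_cost_def)
    qed
  qed (simp add: vwalk_def)
  then show ?thesis
    using assms(2) unfolding boundary_costs_eq by auto
qed

text \<open>The induction counts the vertices with a smaller value of \<open>u\<close>. A minimizing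
  neighbour \<open>y\<close> has \<open>u y < u x\<close> because arc costs are positive, so the
  count drops: \<open>y\<close> itself is no longer included.\<close>

lemma solution_in_boundary_costs:
  assumes u: "eikonal_solution G w Vb \<rho> u" and "x \<in> pverts G"
  shows "u x \<in> boundary_costs x"
  using assms(2)
proof (induction "card {z \<in> pverts G. u z < u x}" arbitrary: x rule: less_induct)
  case less
  show ?case
  proof (cases "x \<in> Vb")
    case True
    then show ?thesis
      using u zero_in_boundary_costs unfolding eikonal_solution_def by simp
  next
    case False
    then obtain y where y: "(x, y) \<in> parcs G" "u x = u y + arc_cost x y"
      using u less.prems unfolding eikonal_solution_iff_Bellman by blast
    then have "u y < u x" "y \<in> pverts G"
      using arc_cost_pos in_arcsD2 by auto
    then have "{z \<in> pverts G. u z < u y} \<subset> {z \<in> pverts G. u z < u x}"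
      by (auto simp: psubset_eq)
    then have "u y \<in> boundary_costs y"
      using less.hyps \<open>y \<in> pverts G\<close> pair_finite_verts by (simp add: psubset_card_mono)
    then show ?thesis
      using boundary_costs_step y by simp
  qed
qed

lemma solution_is_minimum:
  assumes "eikonal_solution G w Vb \<rho> u" and "x \<in> pverts G"
  shows "is_minimum (boundary_costs x) (u x)"
  using assms solution_le_path_cost solution_in_boundary_costs
  unfolding is_minimum_def by blast

section \<open>Existence and uniqueness\<close>

text \<open>The candidate is an infimum because attainment is not yet known; it follows afterwards
  from \<open>solution_is_minimum\<close>. Only values on vertices are prescribed, so that the lemma
  covers a restricted function.\<close>

lemma Inf_boundary_costs_solution:
  assumes u: "\<And>x. x \<in> pverts G \<Longrightarrow> u x = Inf (boundary_costs x)"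
  shows "eikonal_solution G w Vb \<rho> u"
proof -
  have lower: "u x \<le> s" if "x \<in> pverts G" "s \<in> boundary_costs x" for x s
    using that u boundary_costs_nonneg by (auto intro!: cInf_lower bdd_belowI)
  have greatest: "a \<le> u x" if "x \<in> pverts G" "\<And>s. s \<in> boundary_costs x \<Longrightarrow> a \<le> s" for x a
    using that u boundary_costs_nonempty by (auto intro!: cInf_greatest)
  have le: "u x \<le> u y + arc_cost x y" if "(x, y) \<in> parcs G" for x y
  proof -
    have "u x - arc_cost x y \<le> t" if "t \<in> boundary_costs y" for t
      using lower[OF in_arcsD1 boundary_costs_step, OF \<open>(x, y) \<in> parcs G\<close> \<open>(x, y) \<in> parcs G\<close> that]
      by simp
    then have "u x - arc_cost x y \<le> u y"
      using greatest in_arcsD2[OF that] by blast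
    then show ?thesis by simp
  qed
  have "\<exists>y. (x, y) \<in> parcs G \<and> u x = u y + arc_cost x y" if x: "x \<in> pverts G - Vb" for x
  proof -
    \<comment> \<open>Finitely many neighbours give an attained minimum of the right-hand sides. It
      bounds every cost at \<open>x\<close> from below by splitting off the first arc, hence is at
      most the infimum \<open>u x\<close>.\<close>
    let ?A = "(\<lambda>y. u y + arc_cost x y) ` {y. (x, y) \<in> parcs G}"
    have A: "finite ?A" "?A \<noteq> {}"
      using finite_neighbours neighbours_nonempty[OF x] by auto
    then have "Min ?A \<in> ?A"
      by (rule Min_in)
    then obtain y where y: "(x, y) \<in> parcs G" "Min ?A = u y + arc_cost x y"
      by blast
    have "Min ?A \<le> s" if s: "s \<in> boundary_costs x" for s
    proof -
      obtain z t where z: "(x, z) \<in> parcs G" "t \<in> boundary_costs z" "s = t + arc_cost x z"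
        using boundary_costs_cases[OF s] x by blast
      have "Min ?A \<le> u z + arc_cost x z"
        using A z by (intro Min_le) auto
      then show ?thesis
        using lower[OF in_arcsD2[OF z(1)] z(2)] z(3) by simp
    qed
    then have "Min ?A \<le> u x"
      using greatest x by blast
    then show ?thesis
      using y le[OF y(1)] by (intro exI[of _ y]) simp
  qed
  moreover have "u x = 0" if "x \<in> Vb" for x
    using that Vb_subset lower zero_in_boundary_costs greatest boundary_costs_nonneg
    by (intro antisym) auto
  ultimately show ?thesis
    using le unfolding eikonal_solution_iff_Bellman by blast
qed

text \<open>Extensional functions, equal to \<open>undefined\<close> off the vertices, make
  uniqueness in HOL mean uniqueness on \<open>pverts G\<close>. Two solutions agree there since both
  are the minimum of the same set.\<close>

lemma ex1_solution: "\<exists>!u. u \<in> pverts G \<rightarrow>\<^sub>E UNIV \<and> eikonal_solution G w Vb \<rho> u"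
proof (rule ex_ex1I)
  have "eikonal_solution G w Vb \<rho> (restrict (\<lambda>x. Inf (boundary_costs x)) (pverts G))"
    by (rule Inf_boundary_costs_solution) simp
  then show "\<exists>u. u \<in> pverts G \<rightarrow>\<^sub>E UNIV \<and> eikonal_solution G w Vb \<rho> u"
    by (intro exI[of _ "restrict (\<lambda>x. Inf (boundary_costs x)) (pverts G)"]) simp
next
  fix u v
  assume "u \<in> pverts G \<rightarrow>\<^sub>E UNIV \<and> eikonal_solution G w Vb \<rho> u"
    and "v \<in> pverts G \<rightarrow>\<^sub>E UNIV \<and> eikonal_solution G w Vb \<rho> v"
  then show "u = v"
    by (meson PiE_ext is_minimum_unique solution_is_minimum)
qed

end

theorem theorem4p1:
  fixes G :: "'a pair_pre_digraph"
    and w :: "'a \<Rightarrow> 'a \<Rightarrow> real"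
    and Vb :: "'a set"
    and \<rho> :: "nat \<Rightarrow> 'a \<Rightarrow> real"
    and \<delta> :: real
  assumes "pair_graph G"
    and "Digraph_Component.connected (with_proj G)"
    and "edge_weights G w"
    and "Vb \<subseteq> pverts G" and "Vb \<noteq> {}"
    and "\<delta> > 0"
    and "\<And>n x. x \<in> pverts G \<Longrightarrow> 0 \<le> \<rho> n x \<and> \<rho> n x \<le> 1 - \<delta>"
  shows "\<forall>n.
    (\<exists>!u. u \<in> pverts G \<rightarrow>\<^sub>E UNIV \<and> eikonal_solution G w Vb (\<rho> n) u) \<and>
    (\<forall>u \<in> pverts G \<rightarrow>\<^sub>E UNIV. eikonal_solution G w Vb (\<rho> n) u \<longrightarrow>
       (\<forall>x\<in>pverts G.
          is_minimum {path_cost w (\<rho> n) p | y p. y \<in> Vb \<and> p \<in> vertex_paths G x y} (u x)))"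
proof
  fix n
  interpret pair_graph G by fact
  \<comment> \<open>The strict inequality \<open>\<rho> n x < 1\<close> comes from
    \<open>\<rho> n x \<le> 1 - \<delta>\<close> and \<open>\<delta> > 0\<close>.\<close>
  interpret eikonal_graph G w Vb "\<rho> n"
    using assms by unfold_locales (auto, smt (verit))
  show "(\<exists>!u. u \<in> pverts G \<rightarrow>\<^sub>E UNIV \<and> eikonal_solution G w Vb (\<rho> n) u) \<and>
    (\<forall>u \<in> pverts G \<rightarrow>\<^sub>E UNIV. eikonal_solution G w Vb (\<rho> n) u \<longrightarrow>
       (\<forall>x\<in>pverts G.
          is_minimum {path_cost w (\<rho> n) p | y p. y \<in> Vb \<and> p \<in> vertex_paths G x y} (u x)))"
    using ex1_solution solution_is_minimum unfolding boundary_costs_def by blast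
qed

end
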